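(* Let $D$ be a non-singular real $3\times 3$ matrix, and consider the pair of tetrahedra $P_1P_2P_3P_4$ (fixed) and $Q_1Q_2Q_3Q_4$ (moving) derived from the general parallelepiped that is the image under $D$ of the cube with vertices $(\pm1,\pm1,\pm1)$, where $P_i=DP_i^0$ with $P_1^0=(1,-1,-1)$, $P_2^0=(-1,1,-1)$, $P_3^0=(-1,-1,1)$, $P_4^0=(1,1,1)$, and in the basic position $Q_i$ is $-P_i$. For them the generalized admitted finite motions are identical with the admitted finite motions; that is, an isometry $\Phi(x)=Ax+b$ of $\mathbb{R}^3$ with $A\in SO(3)$, $b\in\mathbb{R}^3$, is a generalized admitted motion if and only if it is an admitted motion.
   Context: A motion is an isometry $\Phi(x)=Ax+b$ of $\mathbb{R}^3$ of determinant $+1$; it is applied to the basic position of the moving tetrahedron, so its vertices become $Q_i=\Phi(-P_i)$, $i=1,\dots,4$, while $P_1P_2P_3P_4$ stays fixed. Admitted motion: for every permutation $(ijkl)$ of $\{1,2,3,4\}$, the points $P_i,P_j,Q_k,Q_l$ are coplanar (i.e. each pair of edges of the two tetrahedra which were originally the diagonals of a face of the parallelepiped remains coplanar). Generalized admitted motion: for every permutation $(ijkl)$ of $\{1,2,3,4\}$, the signed volume of the tetrahedron $P_iP_jQ_kQ_l$ is either $0$ or has the opposite sign to that of the tetrahedron $P_iP_jR_kR_l$, where the segment $R_kR_l$ is the translate of the basic position $(-P_k)(-P_l)$ of the segment $Q_kQ_l$ whose midpoint is the centre (the origin) of the parallelepiped; i.e. $R_k=(P_l-P_k)/2$, $R_l=(P_k-P_l)/2$.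 The signed volume of a tetrahedron $XYZW$ is $\frac16\det(Y-X,\,Z-X,\,W-X)$. *)

theory Defs
  imports "HOL-Analysis.Analysis"
begin

text \<open>Alternate vertices of the cube \<open>[-1,1]\<^sup>3\<close>; only the indices \<open>1,\<dots>,4\<close> are meaningful.\<close>

definition P0 :: "nat \<Rightarrow> real^3" where
  "P0 i = (if i = 1 then vector [1, -1, -1]
           else if i = 2 then vector [-1, 1, -1]
           else if i = 3 then vector [-1, -1, 1]
           else vector [1, 1, 1])"

definition P :: "real^3^3 \<Rightarrow> nat \<Rightarrow> real^3" where
  "P D i = D *v P0 i"

definition Q :: "real^3^3 \<Rightarrow> (real^3 \<Rightarrow> real^3) \<Rightarrow> nat \<Rightarrow> real^3" where
  "Q D \<Phi> i = \<Phi> (- P D i)"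

definition motion :: "(real^3 \<Rightarrow> real^3) \<Rightarrow> bool" where
  "motion \<Phi> \<longleftrightarrow> (\<exists>A b. rotation_matrix A \<and> \<Phi> = (\<lambda>x. A *v x + b))"

definition coplanar :: "(real^3) set \<Rightarrow> bool" where
  "coplanar S \<longleftrightarrow> (\<exists>n c. n \<noteq> 0 \<and> S \<subseteq> {x. n \<bullet> x = c})"

definition signed_volume :: "real^3 \<Rightarrow> real^3 \<Rightarrow> real^3 \<Rightarrow> real^3 \<Rightarrow> real" where
  "signed_volume X Y Z W = det (vector [Y - X, Z - X, W - X] :: real^3^3) / 6"

text \<open>\<open>R D k l\<close> is the vertex \<open>R\<^sub>k\<close> of the segment \<open>R\<^sub>kR\<^sub>l\<close>, the translate centred at the origin
  of the segment from \<open>-P\<^sub>k\<close> to \<open>-P\<^sub>l\<close>; its other vertex \<open>R\<^sub>l\<close> is \<open>R D l k\<close>.\<close>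

definition R :: "real^3^3 \<Rightarrow> nat \<Rightarrow> nat \<Rightarrow> real^3" where
  "R D k l = (1/2) *\<^sub>R (P D l - P D k)"

definition admitted_motion :: "real^3^3 \<Rightarrow> (real^3 \<Rightarrow> real^3) \<Rightarrow> bool" where
  "admitted_motion D \<Phi> \<longleftrightarrow> motion \<Phi> \<and>
     (\<forall>\<pi>. \<pi> permutes {1..4} \<longrightarrow>
        coplanar {P D (\<pi> 1), P D (\<pi> 2), Q D \<Phi> (\<pi> 3), Q D \<Phi> (\<pi> 4)})"

definition generalized_admitted_motion :: "real^3^3 \<Rightarrow> (real^3 \<Rightarrow> real^3) \<Rightarrow> bool" where
  "generalized_admitted_motion D \<Phi> \<longleftrightarrow> motion \<Phi> \<and>
     (\<forall>\<pi>. \<pi> permutes {1..4} \<longrightarrow>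
        (let i = \<pi> 1; j = \<pi> 2; k = \<pi> 3; l = \<pi> 4;
             v = signed_volume (P D i) (P D j) (Q D \<Phi> k) (Q D \<Phi> l);
             v' = signed_volume (P D i) (P D j) (R D k l) (R D l k)
         in v = 0 \<or> (v < 0 \<and> v' > 0) \<or> (v > 0 \<and> v' < 0)))"

end

theory Submission
  imports Defs
begin

text \<open>Up to a positive factor, the signed volumes \<open>P\<^sub>iP\<^sub>jR\<^sub>kR\<^sub>l\<close> for the even permutations \<open>(ijkl)\<close> all
  equal \<open>det (P\<^sub>1, P\<^sub>2, P\<^sub>3)\<close>. On the other hand, the six signed volumes \<open>P\<^sub>iP\<^sub>jQ\<^sub>kQ\<^sub>l\<close> for even \<open>(ijkl)\<close>
  (one for each pair \<open>{i, j}\<close>) add up to \<open>0\<close>: the translation part cancels since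
  \<open>P\<^sub>1 + P\<^sub>2 + P\<^sub>3 + P\<^sub>4 = 0\<close>, and what remains is a multiple of \<open>trace A - trace (cofactor A)\<close>, which
  vanishes because a rotation matrix is its own cofactor matrix. Hence if none of these volumes has
  the sign of its counterpart, they are all \<open>0\<close>.\<close>

lemma det_vector_3:
  fixes x y z :: "real^3"
  shows "det (vector [x, y, z] :: real^3^3) =
    x$1 * (y$2 * z$3 - y$3 * z$2) + x$2 * (y$3 * z$1 - y$1 * z$3) + x$3 * (y$1 * z$2 - y$2 * z$1)"
  by (simp add: det_3 algebra_simps)

lemma det_vector_matrix_mult:
  fixes A :: "real^3^3" and x y z :: "real^3"
  shows "det (vector [A *v x, A *v y, A *v z] :: real^3^3) = det A * det (vector [x, y, z] :: real^3^3)"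
proof -
  have "(vector [A *v x, A *v y, A *v z] :: real^3^3) = vector [x, y, z] ** transpose A"
    by (simp add: vec_eq_iff forall_3 matrix_matrix_mult_def matrix_vector_mult_def sum_3 transpose_def
        mult.commute)
  then show ?thesis
    by (simp add: det_mul det_transpose mult.commute)
qed

text \<open>This is the derivative of \<open>det\<close> at the identity: both sides are the
  coefficient of t in det (I + t A) det (x, y, z).\<close>

lemma det_vector_trace:
  fixes A :: "real^3^3" and x y z :: "real^3"
  shows "det (vector [A *v x, y, z] :: real^3^3) + det (vector [x, A *v y, z] :: real^3^3)
    + det (vector [x, y, A *v z] :: real^3^3) = trace A * det (vector [x, y, z] :: real^3^3)"
  unfolding det_vector_3 trace_def sum_3 matrix_vector_mult_def
  by (simp add: sum_3 algebra_simps)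

text \<open>As \<open>x\<close> is \<open>A *v (transpose A *v x)\<close>, the factor
  \<open>A\<close> comes out of all three rows at once, with determinant 1.\<close>

lemma det_vector_rotation:
  fixes A :: "real^3^3" and x y z :: "real^3"
  assumes "rotation_matrix A"
  shows "det (vector [x, A *v y, A *v z] :: real^3^3) = det (vector [transpose A *v x, y, z] :: real^3^3)"
proof -
  have "A *v (transpose A *v x) = x"
    using assms
    by (simp add: rotation_matrix_def orthogonal_matrix_def matrix_vector_mul_assoc
        del: transpose_matrix_vector)
  then show ?thesis
    using det_vector_matrix_mult[of A "transpose A *v x" y z] assms
    by (simp add: rotation_matrix_def)
qed

lemma det_vector_rotate:
  fixes x y z :: "real^3"
  shows "det (vector [x, y, z] :: real^3^3) = det (vector [y, z, x] :: real^3^3)"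
  unfolding det_vector_3 by (simp add: algebra_simps)

text \<open>Moving \<open>A\<close> across as \<open>transpose A\<close> leaves one matrix factor in
  each term instead of two, so the trace identity for \<open>transpose A\<close> applies.\<close>

lemma det_vector_rotation_trace:
  fixes A :: "real^3^3" and x y z :: "real^3"
  assumes "rotation_matrix A"
  shows "det (vector [x, A *v y, A *v z] :: real^3^3) + det (vector [A *v x, y, A *v z] :: real^3^3)
    + det (vector [A *v x, A *v y, z] :: real^3^3) = trace A * det (vector [x, y, z] :: real^3^3)"
proof -
  note rot = det_vector_rotation[OF assms]
  have "trace (transpose A) = trace A"
    by (simp add: trace_def transpose_def)
  moreover have "det (vector [A *v x, y, A *v z] :: real^3^3) = det (vector [x, transpose A *v y, z] :: real^3^3)"
    by (metis rot det_vector_rotate)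
  moreover have "det (vector [A *v x, A *v y, z] :: real^3^3) = det (vector [x, y, transpose A *v z] :: real^3^3)"
    by (metis rot det_vector_rotate)
  ultimately show ?thesis
    using det_vector_trace[of "transpose A" x y z] rot[of x y z] by simp
qed

text \<open>Multilinear expansion sorted by degree: the first term carries the whole translation
  \<open>b\<close>; the other two are linear and quadratic in \<open>r\<close>,
  \<open>s\<close>.\<close>

lemma signed_volume_reflected:
  fixes p q r s b :: "real^3"
  shows "signed_volume p q (b - r) (b - s) = (det (vector [q - p, b, r - s] :: real^3^3)
    + det (vector [p, q, r - s] :: real^3^3) + det (vector [q - p, r, s] :: real^3^3)) / 6"
  unfolding signed_volume_def det_vector_3 by (simp add: algebra_simps)

text \<open>The primed points stand for the images under \<open>A\<close>. Eliminating
  \<open>s\<close> and \<open>s'\<close>, the three kinds of terms of the expansion are summed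
  separately, with factors 0, 4 and -4; division by 6 gives 2/3.\<close>

lemma sum_signed_volume:
  fixes p q r s p' q' r' s' b :: "real^3"
  assumes "p + q + r + s = 0" and "p' + q' + r' + s' = 0"
  shows "signed_volume p q (b - r') (b - s') + signed_volume r s (b - p') (b - q')
    + signed_volume p r (b - s') (b - q') + signed_volume s q (b - p') (b - r')
    + signed_volume p s (b - q') (b - r') + signed_volume q r (b - p') (b - s')
    = 2/3 * ((det (vector [p', q, r] :: real^3^3) + det (vector [p, q', r] :: real^3^3)
        + det (vector [p, q, r'] :: real^3^3))
      - (det (vector [p, q', r'] :: real^3^3) + det (vector [p', q, r'] :: real^3^3)
        + det (vector [p', q', r] :: real^3^3)))"
proof -
  have s: "s = - p - q - r" "s' = - p' - q' - r'"
    using assms by (simp_all add: algebra_simps add_eq_0_iff)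
  let ?d = "\<lambda>x y z. det (vector [x, y, z] :: real^3^3)"
  have "?d (q - p) b (r' - s') + ?d (s - r) b (p' - q') + ?d (r - p) b (s' - q')
      + ?d (q - s) b (p' - r') + ?d (s - p) b (q' - r') + ?d (r - q) b (p' - s') = 0"
    unfolding s det_vector_3 by (simp add: algebra_simps)
  moreover have "?d p q (r' - s') + ?d r s (p' - q') + ?d p r (s' - q') + ?d s q (p' - r')
      + ?d p s (q' - r') + ?d q r (p' - s') = 4 * (?d p' q r + ?d p q' r + ?d p q r')"
    unfolding s det_vector_3 by (simp add: algebra_simps)
  moreover have "?d (q - p) r' s' + ?d (s - r) p' q' + ?d (r - p) s' q' + ?d (q - s) p' r'
      + ?d (s - p) q' r' + ?d (r - q) p' s' = - 4 * (?d p q' r' + ?d p' q r' + ?d p' q' r)"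
    unfolding s det_vector_3 by (simp add: algebra_simps)
  ultimately show ?thesis
    unfolding signed_volume_reflected by argo
qed

text \<open>With m = (s - r)/2 the last two points are m and -m, so the determinant is -2 det (p, q,
  m), and m is -r modulo the span of p and q.\<close>

lemma signed_volume_centred:
  fixes p q r s :: "real^3"
  assumes "p + q + r + s = 0"
  shows "signed_volume p q ((1/2) *\<^sub>R (s - r)) ((1/2) *\<^sub>R (r - s)) = det (vector [p, q, r] :: real^3^3) / 3"
proof -
  have s: "s = - p - q - r"
    using assms by (simp add: algebra_simps add_eq_0_iff)
  show ?thesis
    unfolding s signed_volume_def det_vector_3 by (simp add: field_simps)
qed

text \<open>A normal of a common plane is a nonzero kernel vector of the matrix of edges from
  \<open>X\<close>.\<close>

lemma coplanar_iff_signed_volume: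
  "coplanar {X, Y, Z, W} \<longleftrightarrow> signed_volume X Y Z W = 0"
proof -
  have ker_iff: "(\<exists>n. n \<noteq> 0 \<and> M *v n = 0) \<longleftrightarrow> det M = 0" for M :: "real^3^3"
    using invertible_det_nz[of M] matrix_left_invertible_ker[of M]
    unfolding invertible_left_inverse by blast
  have ker: "(vector [Y - X, Z - X, W - X] :: real^3^3) *v n = 0 \<longleftrightarrow>
      n \<bullet> Y = n \<bullet> X \<and> n \<bullet> Z = n \<bullet> X \<and> n \<bullet> W = n \<bullet> X" for n
    by (simp add: vec_eq_iff[of _ 0] forall_3 matrix_vector_mul_component inner_commute[of n]
        inner_diff_left)
  have "coplanar {X, Y, Z, W} \<longleftrightarrow>
      (\<exists>n. n \<noteq> 0 \<and> (vector [Y - X, Z - X, W - X] :: real^3^3) *v n = 0)"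
    unfolding coplanar_def ker by auto
  then show ?thesis
    unfolding signed_volume_def using ker_iff by simp
qed

text \<open>With plain index quadruples, a condition can be instantiated at reordered indices
  without building a permutation.\<close>

lemma all_permutes_iff:
  fixes H :: "nat \<Rightarrow> nat \<Rightarrow> nat \<Rightarrow> nat \<Rightarrow> bool"
  shows "(\<forall>\<pi>. \<pi> permutes {1..4} \<longrightarrow> H (\<pi> 1) (\<pi> 2) (\<pi> 3) (\<pi> 4)) \<longleftrightarrow>
    (\<forall>i j k l. {i, j, k, l} = {1..4} \<longrightarrow> H i j k l)" (is "?L \<longleftrightarrow> ?R")
proof
  have set: "{1..4} = {1, 2, 3, 4 :: nat}"
    by auto
  show ?R if ?L
  proof (intro allI impI)
    fix i j k l :: nat
    assume eq: "{i, j, k, l} = {1..4}"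
    define \<pi> where "\<pi> n = (if n = 1 then i else if n = 2 then j else if n = 3 then k
      else if n = 4 then l else n)" for n
    have "\<pi> ` {1..4} = {i, j, k, l}"
      unfolding set by (auto simp: \<pi>_def)
    then have "\<pi> ` {1..4} = {1..4}"
      unfolding eq .
    then have "\<pi> permutes {1..4}"
      \<comment> \<open>A map of a finite set onto itself is injective; outside the set
        \<open>\<pi>\<close> is the identity.\<close>
      by (intro bij_imp_permutes) (auto simp: bij_betw_def \<pi>_def intro: eq_card_imp_inj_on)
    with that show "H i j k l"
      by (force simp: \<pi>_def)
  qed
  show ?L if ?R
  proof (intro allI impI)
    fix \<pi> :: "nat \<Rightarrow> nat"
    assume "\<pi> permutes {1..4}"
    then have "{\<pi> 1, \<pi> 2, \<pi> 3, \<pi> 4} = {1..4}"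
      using permutes_image[of \<pi> "{1..4}"] unfolding set by simp
    with that show "H (\<pi> 1) (\<pi> 2) (\<pi> 3) (\<pi> 4)"
      by blast
  qed
qed

lemma sum_P:
  assumes "{i, j, k, l} = {1..4}"
  shows "P D i + P D j + P D k + P D l = 0"
proof -
  \<comment> \<open>Distinctness of the indices turns the four summands into a sum over a
    set.\<close>
  have "card {i, j, k, l} = 4"
    using assms by simp
  then have "distinct [i, j, k, l]"
    by (intro card_distinct) simp
  then have "P0 i + P0 j + P0 k + P0 l = (\<Sum>m\<in>{i, j, k, l}. P0 m)"
    by (simp add: add.assoc)
  also have "\<dots> = (\<Sum>m\<in>{1, 2, 3, 4}. P0 m)"
    unfolding assms by (rule sum.cong) auto
  also have "\<dots> = 0"
    by (simp add: P0_def vec_eq_iff forall_3)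
  finally show ?thesis
    by (simp add: P_def flip: matrix_vector_right_distrib)
qed

theorem theorem3:
  fixes D A :: "real^3^3" and b :: "real^3"
  assumes "invertible D" and "rotation_matrix A"
  shows "generalized_admitted_motion D (\<lambda>x. A *v x + b)
           \<longleftrightarrow> admitted_motion D (\<lambda>x. A *v x + b)"
proof -
  define v where "v i j k l = signed_volume (P D i) (P D j) (b - A *v P D k) (b - A *v P D l)" for i j k l
  define v' where "v' i j k l = signed_volume (P D i) (P D j) (R D k l) (R D l k)" for i j k l
  have Q: "Q D (\<lambda>x. A *v x + b) k = b - A *v P D k" for k
    by (simp add: Q_def vec.neg)
  have v'_eq: "v' i j k l = det (vector [P D i, P D j, P D k] :: real^3^3) / 3"
    if "{i, j, k, l} = {1..4}" for i j k l
    unfolding v'_def R_def by (rule signed_volume_centred) (rule sum_P[OF that])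
  have sum_v: "v i j k l + v k l i j + v i k l j + v l j i k + v i l j k + v j k i l = 0"
    if "{i, j, k, l} = {1..4}" for i j k l
  proof -
    have P: "P D i + P D j + P D k + P D l = 0"
      by (rule sum_P[OF that])
    then have "A *v P D i + A *v P D j + A *v P D k + A *v P D l = 0"
      by (simp flip: matrix_vector_right_distrib)
    \<comment> \<open>Both brackets equal \<open>trace A\<close> times the same determinant, so
      their difference vanishes.\<close>
    from sum_signed_volume[OF P this, of b] show ?thesis
      by (simp add: v_def det_vector_trace det_vector_rotation_trace[OF assms(2)])
  qed
  have "v i j k l = 0"
    if gen: "\<And>i j k l. {i, j, k, l} = {1..4} \<Longrightarrow>
        v i j k l = 0 \<or> (v i j k l < 0 \<and> v' i j k l > 0) \<or> (v i j k l > 0 \<and> v' i j k l < 0)"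
      and ijkl: "{i, j, k, l} = {1..4}" for i j k l
  proof -
    define \<delta> where "\<delta> = det (vector [P D i, P D j, P D k] :: real^3^3) / 3"
    have P: "P D l = - P D i - P D j - P D k"
      using sum_P[OF ijkl, of D] by (simp add: algebra_simps add_eq_0_iff)
    \<comment> \<open>The index patterns of the other five summands in \<open>sum_v\<close>.\<close>
    have even: "{k, l, i, j} = {1..4}" "{i, k, l, j} = {1..4}" "{l, j, i, k} = {1..4}"
      "{i, l, j, k} = {1..4}" "{j, k, i, l} = {1..4}"
      unfolding ijkl[symmetric] by auto
    have v': "v' i j k l = \<delta>" "v' k l i j = \<delta>" "v' i k l j = \<delta>" "v' l j i k = \<delta>"
      "v' i l j k = \<delta>" "v' j k i l = \<delta>"
      unfolding v'_eq[OF ijkl] even[THEN v'_eq] \<delta>_def P det_vector_3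
      by (simp_all add: algebra_simps)
    note gens = gen[OF ijkl] even[THEN gen]
    show ?thesis
    proof (cases "\<delta> > 0")
      case True
      then have "x \<le> 0" if "x = 0 \<or> (x < 0 \<and> \<delta> > 0) \<or> (x > 0 \<and> \<delta> < 0)" for x :: real
        using that by auto
      from gens[unfolded v', THEN this] sum_v[OF ijkl] show ?thesis
        by linarith
    next
      \<comment> \<open>This includes \<open>\<delta> = 0\<close>, where the condition leaves only
        \<open>x = 0\<close>.\<close>
      case False
      then have "x \<ge> 0" if "x = 0 \<or> (x < 0 \<and> \<delta> > 0) \<or> (x > 0 \<and> \<delta> < 0)" for x :: real
        using that by auto
      from gens[unfolded v', THEN this] sum_v[OF ijkl] show ?thesis
        by linarith
    qed
  qed
  then have "(\<forall>i j k l. {i, j, k, l} = {1..4} \<longrightarrow>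
        v i j k l = 0 \<or> (v i j k l < 0 \<and> v' i j k l > 0) \<or> (v i j k l > 0 \<and> v' i j k l < 0)) \<longleftrightarrow>
      (\<forall>i j k l. {i, j, k, l} = {1..4} \<longrightarrow> v i j k l = 0)"
    by blast
  then show ?thesis
    unfolding generalized_admitted_motion_def admitted_motion_def Let_def
      coplanar_iff_signed_volume Q v_def[symmetric] v'_def[symmetric]
      all_permutes_iff[where H = "\<lambda>i j k l. v i j k l = 0"]
      all_permutes_iff[where H = "\<lambda>i j k l. v i j k l = 0 \<or> (v i j k l < 0 \<and> v' i j k l > 0)
        \<or> (v i j k l > 0 \<and> v' i j k l < 0)"]
    by simp
qed

end
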